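(* For each $d\in\mathbb{N}$ and each $N\in\mathbb{N}$ there exists a set $W(N,d)$ of at most $C_dN^{\alpha_d}(\log N)^{\beta_d}$ points in $[0,2\pi)^d$ such that for all $f\in\mathcal{T}(N)$, $$\|f\|_\infty\le C(d)\max_{\mathbf{w}\in W(N,d)}|f(\mathbf{w})| .$$
   Context: $C_d$ and $C(d)$ denote positive constants depending only on $d$. Here $\alpha_d:=\sum_{j=1}^d\frac1j$ and $\beta_d:=d-\alpha_d$. The hyperbolic cross is $\Gamma(N)=\Gamma(N,d):=\{\mathbf{k}\in\mathbb{Z}^d:\ \prod_{j=1}^d\max\{|k_j|,1\}\le N\}$, and $\mathcal{T}(N)=\mathcal{T}(N,d)$ is the set of all trigonometric polynomials $f(\mathbf{x})=\sum_{\mathbf{k}\in\Gamma(N)}c_{\mathbf{k}}e^{i(\mathbf{k},\mathbf{x})}$ with $c_{\mathbf{k}}\in\mathbb{C}$, where $(\mathbf{k},\mathbf{x})=\sum_{j=1}^d k_jx_j$. The norm $\|f\|_\infty$ is the maximum of $|f|$ over the torus $\mathbb{T}^d$, identified with $[0,2\pi)^d$.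
   Formalization: At N = 1 the factor log N is replaced by log 2: for d ≥ 2 the printed bound is 0 there, which would force W(1,d) to be empty although nonzero constants lie in T(1); for every N ≥ 2 the bound is as printed. *)

theory Defs
  imports "HOL-Analysis.Analysis"
begin

definition alpha :: "nat \<Rightarrow> real" where
  "alpha d = (\<Sum>j = 1..d. 1 / real j)"

definition beta :: "nat \<Rightarrow> real" where
  "beta d = real d - alpha d"

text \<open>This is log N for N at least 2. At N = 1 the factor (log N) ^ beta d would vanish for
  d at least 2, allowing no sampling points at all although constants are trigonometric
  polynomials; there any positive value will do. Positivity also avoids the convention
  0 powr 0 = 0 in dimension 1, where beta 1 = 0.\<close>

definition log_factor :: "nat \<Rightarrow> real" where
  "log_factor N = ln (real (max N 2))"

definition hyperbolic_cross :: "nat \<Rightarrow> (int ^ 'd) set" where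
  "hyperbolic_cross N = {k. (\<Prod>j\<in>UNIV. max \<bar>k $ j\<bar> 1) \<le> int N}"

text \<open>Finiteness matters below: a sum over an infinite set would be 0 by convention.\<close>

lemma finite_hyperbolic_cross: "finite (hyperbolic_cross N :: (int ^ 'd) set)"
proof -
  have bound: "\<bar>k $ i\<bar> \<le> int N" if "k \<in> hyperbolic_cross N" for k :: "int ^ 'd" and i
  proof -
    have "(\<Prod>j\<in>UNIV. max \<bar>k $ j\<bar> 1) =
        max \<bar>k $ i\<bar> 1 * (\<Prod>j\<in>UNIV - {i}. max \<bar>k $ j\<bar> 1)"
      by (rule prod.remove) auto
    moreover have "1 \<le> (\<Prod>j\<in>UNIV - {i}. max \<bar>k $ j\<bar> 1)"
      by (rule prod_ge_1) auto
    ultimately have "max \<bar>k $ i\<bar> 1 \<le> (\<Prod>j\<in>UNIV. max \<bar>k $ j\<bar> 1)"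
      using mult_left_mono[of 1 "\<Prod>j\<in>UNIV - {i}. max \<bar>k $ j\<bar> 1" "max \<bar>k $ i\<bar> 1"]
      by simp
    with that show ?thesis
      by (simp add: hyperbolic_cross_def)
  qed
  have "hyperbolic_cross N \<subseteq>
      vec_lambda ` (PiE UNIV (\<lambda>_ :: 'd. {- int N..int N}))"
  proof
    fix k :: "int ^ 'd"
    assume k: "k \<in> hyperbolic_cross N"
    have "- int N \<le> k $ i \<and> k $ i \<le> int N" for i
      using bound[OF k, of i] by linarith
    then have "vec_nth k \<in> PiE UNIV (\<lambda>_. {- int N..int N})"
      by auto
    then have "vec_lambda (vec_nth k) \<in> vec_lambda ` (PiE UNIV (\<lambda>_. {- int N..int N}))"
      by (rule imageI)
    then show "k \<in> vec_lambda ` (PiE UNIV (\<lambda>_. {- int N..int N}))"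
      by simp
  qed
  then show ?thesis
    by (rule finite_subset) (intro finite_imageI finite_PiE; simp)
qed

definition trig_polys :: "nat \<Rightarrow> (real ^ 'd \<Rightarrow> complex) set" where
  "trig_polys N = {f. \<exists>c :: int ^ 'd \<Rightarrow> complex. f = (\<lambda>x.
     \<Sum>k\<in>hyperbolic_cross N.
       c k * exp (\<i> * complex_of_real (\<Sum>j\<in>UNIV. real_of_int (k $ j) * x $ j)))}"

definition torus :: "(real ^ 'd) set" where
  "torus = {x. \<forall>j. 0 \<le> x $ j \<and> x $ j < 2 * pi}"

text \<open>For a trigonometric polynomial this supremum is attained, by continuity and
  periodicity, so it is the maximum.\<close>

definition sup_norm :: "(real ^ 'd \<Rightarrow> complex) \<Rightarrow> real" where
  "sup_norm f = (SUP x\<in>torus. cmod (f x))"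

end

theory Submission
  imports Defs
begin

text \<open>The set is built by induction on the number of free coordinates of a slice of the torus.
  On a slice with a free coordinates, the mixed difference of f with steps of size delta is at most
  C delta^a N (log N)^(a-1) times the maximum of f, so for delta about (N (log N)^(a-1))^(-1/a)
  it is at most half of that maximum. Expanding the mixed difference then shows that the maximum is
  controlled by the values of f at points with at least one coordinate on the grid of step delta,
  that is, on about 1/delta slices with a-1 free coordinates for each coordinate. Multiplying the
  values of 1/delta over a gives the exponents alpha and beta. The bound for the mixed difference is
  obtained coordinate by coordinate, by splitting the spectrum into dyadic blocks with
  de la Vallee Poussin multipliers and applying Bernstein's inequality to each block; summing
  over the blocks of one coordinate costs a factor log N.\<close>

section \<open>Multiplier bounds in one variable\<close>

definition fejer :: "nat \<Rightarrow> int \<Rightarrow> real" where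
  "fejer m k = max 0 (1 - \<bar>real_of_int k\<bar> / real m)"

text \<open>A geometric sum of an \<open>M\<close>-th root of unity, which equals 1 exactly when
  \<open>M\<close> divides \<open>q\<close>.\<close>

lemma sum_cis_roots:
  assumes "M > 0"
  shows "(\<Sum>l<M. cis (real_of_int q * (2 * pi * real l / real M))) =
    (if int M dvd q then of_nat M else 0)"
proof -
  define z where "z = cis (2 * pi * real_of_int q / real M)"
  have pow: "cis (real_of_int q * (2 * pi * real l / real M)) = z ^ l" for l
    unfolding z_def Complex.DeMoivre by (simp add: mult_ac)
  have zM: "z ^ M = 1"
    unfolding z_def Complex.DeMoivre using assms cis_multiple_2pi[of "real_of_int q"] by simp
  have "z = 1 \<longleftrightarrow> int M dvd q"
  proof
    assume "z = 1"
    then have "cos (2 * pi * real_of_int q / real M) = 1"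
      by (simp add: z_def complex_eq_iff)
    then obtain i :: int where "2 * pi * real_of_int q / real M = real_of_int i * 2 * pi"
      by (auto simp: cos_one_2pi_int)
    then have "real_of_int q = real_of_int (i * int M)"
      using assms by (simp add: field_simps)
    then show "int M dvd q"
      by (simp only: of_int_eq_iff) simp
  next
    assume "int M dvd q"
    then obtain i where "q = int M * i" ..
    then have "2 * pi * real_of_int q / real M = 2 * pi * real_of_int i"
      using assms by (simp add: field_simps)
    then show "z = 1"
      by (simp add: z_def cis_multiple_2pi)
  qed
  then show ?thesis
    unfolding pow using zM by (auto simp: geometric_sum)
qed

text \<open>The difference \<open>- k\<close> occurs for \<open>m - \<bar>k\<bar>\<close> pairs if
  \<bar>k\<bar> < m and for none otherwise: the triangle is the normalised autocorrelation of an
  interval of length \<open>m\<close>.\<close>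

lemma fejer_count:
  assumes "m > 0"
  shows "(\<Sum>i<m. \<Sum>j<m. if int i - int j + k = 0 then 1 else 0 :: real) = real m * fejer m k"
proof -
  have "(\<Sum>j<m. if int i - int j + k = 0 then 1 else 0 :: real) =
      (if 0 \<le> int i + k \<and> int i + k < int m then 1 else 0)" for i
  proof -
    have "{j \<in> {..<m}. int i - int j + k = 0} =
        (if 0 \<le> int i + k \<and> int i + k < int m then {nat (int i + k)} else {})"
      by auto
    then show ?thesis
      by (simp flip: sum.inter_filter)
  qed
  then have "(\<Sum>i<m. \<Sum>j<m. if int i - int j + k = 0 then 1 else 0 :: real) =
      real (card {i \<in> {..<m}. 0 \<le> int i + k \<and> int i + k < int m})"
    by (simp flip: sum.inter_filter)
  also have "{i \<in> {..<m}. 0 \<le> int i + k \<and> int i + k < int m} =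
      {nat (- k)..<min m (nat (int m - k))}"
    by auto
  also have "real (card \<dots>) = real m * fejer m k"
    using assms by (auto simp: fejer_def max_def field_simps min_def abs_if)
  finally show ?thesis .
qed

text \<open>The weight \<open>w l\<close> is the Fejer kernel at the \<open>l\<close>-th node
  divided by \<open>M\<close>. Expanding the square leaves the frequencies \<open>i - j + q\<close>,
  all below \<open>M\<close> in modulus, so only the zero frequency is divisible by \<open>M\<close>
  and there is no aliasing.\<close>

lemma fejer_quadrature:
  fixes m M :: nat
  assumes "m > 0"
  defines "w \<equiv> \<lambda>l. (cmod (\<Sum>i<m. cis (real i * (2 * pi * real l / real M))))\<^sup>2 / (real m * real M)"
  assumes "\<bar>q\<bar> + int m < int M"
  shows "(\<Sum>l<M. of_real (w l) * cis (real_of_int q * (2 * pi * real l / real M))) = of_real (fejer m q)"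
proof -
  define u where "u = (\<lambda>l. 2 * pi * real l / real M)"
  have M: "M > 0"
    using assms(3) by linarith
  have "of_real (w l) * cis (real_of_int q * u l) =
      (\<Sum>i<m. \<Sum>j<m. cis (real_of_int (int i - int j + q) * u l)) / (of_nat m * of_nat M)" for l
  proof -
    have "of_real (w l) = (\<Sum>i<m. cis (real i * u l)) * (\<Sum>j<m. cis (- (real j * u l))) /
        (of_nat m * of_nat M)"
      using complex_norm_square[of "\<Sum>i<m. cis (real i * u l)"]
      by (simp add: w_def u_def cis_cnj)
    also have "(\<Sum>i<m. cis (real i * u l)) * (\<Sum>j<m. cis (- (real j * u l))) =
      (\<Sum>i<m. \<Sum>j<m. cis (real i * u l - real j * u l))"
      by (simp add: sum_product cis_mult)
    finally show ?thesis
      by (simp add: sum_distrib_right cis_mult ring_distribs)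
  qed
  then have "(\<Sum>l<M. of_real (w l) * cis (real_of_int q * u l)) =
      (\<Sum>l<M. \<Sum>i<m. \<Sum>j<m. cis (real_of_int (int i - int j + q) * u l)) / (of_nat m * of_nat M)"
    by (simp add: sum_divide_distrib)
  also have "(\<Sum>l<M. \<Sum>i<m. \<Sum>j<m. cis (real_of_int (int i - int j + q) * u l)) =
      (\<Sum>i<m. \<Sum>j<m. \<Sum>l<M. cis (real_of_int (int i - int j + q) * u l))"
    by (subst sum.swap) (rule sum.cong[OF refl], rule sum.swap)
  also have "\<dots> = (\<Sum>i<m. \<Sum>j<m. of_real (real M * (if int i - int j + q = 0 then 1 else 0)))"
  proof (intro sum.cong refl)
    fix i j assume "i \<in> {..<m}" "j \<in> {..<m}"
    then have "\<bar>int i - int j + q\<bar> < int M"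
      using assms(3) by auto
    then have "int M dvd (int i - int j + q) \<longleftrightarrow> int i - int j + q = 0"
      using zdvd_imp_le[of "int M" "\<bar>int i - int j + q\<bar>"] by auto
    then show "(\<Sum>l<M. cis (real_of_int (int i - int j + q) * u l)) =
        of_real (real M * (if int i - int j + q = 0 then 1 else 0))"
      unfolding u_def sum_cis_roots[OF M] by simp
  qed
  also have "\<dots> = of_real (real M * (real m * fejer m q))"
    unfolding fejer_count[OF assms(1), symmetric] of_real_sum sum_distrib_left ..
  finally show ?thesis
    using M assms(1) by (simp add: u_def)
qed

text \<open>On polynomials of bounded degree the Fejer multiplier is an average of translates with
  nonnegative weights of total mass 1, so no convolution integral is needed.\<close>

lemma fejer_bound:
  fixes a :: "'k \<Rightarrow> complex" and \<phi> :: "'k \<Rightarrow> int"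
  assumes "finite K" "m > 0"
    and bd: "\<And>t. cmod (\<Sum>k\<in>K. a k * cis (real_of_int (\<phi> k) * t)) \<le> B"
  shows "cmod (\<Sum>k\<in>K. of_real (fejer m (\<phi> k)) * a k * cis (real_of_int (\<phi> k) * t)) \<le> B"
proof -
  \<comment> \<open>Large enough for the quadrature to be exact at every \<open>\<phi> k\<close> and
    also at 0, which gives the total mass of the weights.\<close>
  define M where "M = m + nat (\<Sum>k\<in>K. \<bar>\<phi> k\<bar>) + 1"
  define u where "u = (\<lambda>l. 2 * pi * real l / real M)"
  define w where "w = (\<lambda>l. (cmod (\<Sum>i<m. cis (real i * (2 * pi * real l / real M))))\<^sup>2 / (real m * real M))"
  have M: "\<bar>\<phi> k\<bar> + int m < int M" if "k \<in> K" for k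
  proof -
    have "\<bar>\<phi> k\<bar> \<le> (\<Sum>k\<in>K. \<bar>\<phi> k\<bar>)"
      by (rule member_le_sum) (use that assms in auto)
    then show ?thesis
      by (simp add: M_def)
  qed
  have "\<bar>0\<bar> + int m < int M"
    using sum_nonneg[of K "\<lambda>k. \<bar>\<phi> k\<bar>"] by (simp add: M_def add_pos_nonneg)
  from fejer_quadrature[OF assms(2) this]
  have "complex_of_real (\<Sum>l<M. w l) = 1"
    by (simp add: w_def fejer_def)
  then have wsum: "(\<Sum>l<M. w l) = 1"
    using of_real_eq_1_iff by blast
  have "(\<Sum>k\<in>K. of_real (fejer m (\<phi> k)) * a k * cis (real_of_int (\<phi> k) * t)) =
      (\<Sum>k\<in>K. (\<Sum>l<M. of_real (w l) * cis (real_of_int (\<phi> k) * u l)) * a k * cis (real_of_int (\<phi> k) * t))"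
    using fejer_quadrature[OF assms(2) M] unfolding w_def u_def by simp
  also have "\<dots> = (\<Sum>k\<in>K. \<Sum>l<M. of_real (w l) * (a k * cis (real_of_int (\<phi> k) * (t + u l))))"
    by (simp add: sum_distrib_left sum_distrib_right ring_distribs mult_ac flip: cis_mult)
  also have "\<dots> = (\<Sum>l<M. of_real (w l) * (\<Sum>k\<in>K. a k * cis (real_of_int (\<phi> k) * (t + u l))))"
    by (subst sum.swap) (simp add: sum_distrib_left)
  also have "cmod \<dots> \<le> (\<Sum>l<M. w l * B)"
  proof (rule sum_norm_le)
    fix l
    have "w l \<ge> 0"
      by (simp add: w_def)
    then show "cmod (of_real (w l) * (\<Sum>k\<in>K. a k * cis (real_of_int (\<phi> k) * (t + u l)))) \<le> w l * B"
      using bd by (simp add: norm_mult mult_left_mono)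
  qed
  also have "\<dots> = B"
    by (simp add: wsum flip: sum_distrib_right)
  finally show ?thesis .
qed

text \<open>Indexing through \<open>\<phi>\<close> allows repeated frequencies: later
  \<open>\<phi>\<close> is one coordinate of a multivariate frequency and the other coordinates are
  absorbed in \<open>a\<close>. The constant 2 comes from two Fejer multipliers, each of norm at
  most 1.\<close>

lemma bernstein:
  fixes a :: "'k \<Rightarrow> complex" and \<phi> :: "'k \<Rightarrow> int"
  assumes "finite K"
    and supp: "\<And>k. k \<in> K \<Longrightarrow> a k \<noteq> 0 \<Longrightarrow> \<bar>\<phi> k\<bar> \<le> int m"
    and bd: "\<And>t. cmod (\<Sum>k\<in>K. a k * cis (real_of_int (\<phi> k) * t)) \<le> B"
  shows "cmod (\<Sum>k\<in>K. of_int (\<phi> k) * a k * cis (real_of_int (\<phi> k) * t)) \<le> 2 * real m * B"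
proof (cases "m = 0")
  case True
  \<comment> \<open>\<open>fejer 0\<close> is constantly 1 by division by zero, so degree 0 is
    separate: only the zero frequency survives, and its factor \<open>\<phi> k\<close>
    vanishes.\<close>
  then have "of_int (\<phi> k) * a k * cis (real_of_int (\<phi> k) * t) = 0" if "k \<in> K" for k
    using supp[OF that] by auto
  then show ?thesis
    using True by (simp add: sum.neutral del: mult_eq_0_iff)
next
  case False
  have shifted: "cmod (\<Sum>k\<in>K. of_real (fejer m (\<phi> k + r)) * a k * cis (real_of_int (\<phi> k) * t)) \<le> B" for r
  proof -
    \<comment> \<open>Shifting all frequencies by \<open>r\<close> multiplies the sum by a
      unimodular number, so the bound for centred triangles also covers those centred at
      \<open>- r\<close>.\<close>
    have shift: "cmod (\<Sum>k\<in>K. b k * cis (real_of_int (\<phi> k + r) * t)) =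
        cmod (\<Sum>k\<in>K. b k * cis (real_of_int (\<phi> k) * t))" for b t
    proof -
      have "(\<Sum>k\<in>K. b k * cis (real_of_int (\<phi> k + r) * t)) =
          cis (real_of_int r * t) * (\<Sum>k\<in>K. b k * cis (real_of_int (\<phi> k) * t))"
        by (simp add: sum_distrib_left algebra_simps flip: cis_mult)
      then show ?thesis
        by (simp add: norm_mult)
    qed
    show ?thesis
      using fejer_bound[OF assms(1), of m a "\<lambda>k. \<phi> k + r" B t] False bd
      unfolding shift by simp
  qed
  \<comment> \<open>The difference of the triangles centred at m and -m is k / m for k between -m and m.\<close>
  have "(\<Sum>k\<in>K. of_int (\<phi> k) * a k * cis (real_of_int (\<phi> k) * t)) =
      of_nat m * ((\<Sum>k\<in>K. of_real (fejer m (\<phi> k + - int m)) * a k * cis (real_of_int (\<phi> k) * t))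
        - (\<Sum>k\<in>K. of_real (fejer m (\<phi> k + int m)) * a k * cis (real_of_int (\<phi> k) * t)))"
    unfolding sum_distrib_left sum_subtractf[symmetric]
  proof (rule sum.cong[OF refl])
    fix k assume k: "k \<in> K"
    show "of_int (\<phi> k) * a k * cis (real_of_int (\<phi> k) * t) =
      of_nat m * (of_real (fejer m (\<phi> k + - int m)) * a k * cis (real_of_int (\<phi> k) * t)
        - of_real (fejer m (\<phi> k + int m)) * a k * cis (real_of_int (\<phi> k) * t))"
    proof (cases "a k = 0")
      case nz: False
      have "real_of_int (\<phi> k) = real m * (fejer m (\<phi> k + - int m) - fejer m (\<phi> k + int m))"
        using supp[OF k nz] False by (auto simp: fejer_def field_simps max_def abs_if split: if_splits)
      then have "complex_of_int (\<phi> k) =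
          of_nat m * (of_real (fejer m (\<phi> k + - int m)) - of_real (fejer m (\<phi> k + int m)))"
        by (metis of_real_diff of_real_mult of_real_of_int_eq of_real_of_nat_eq)
      then show ?thesis
        by (simp only:) (simp add: algebra_simps)
    qed simp
  qed
  also have "cmod \<dots> \<le> real m * (B + B)"
    unfolding norm_mult norm_of_nat
    by (intro mult_left_mono order_trans[OF norm_triangle_ineq4] add_mono shifted) simp
  finally show ?thesis
    by (simp add: algebra_simps)
qed

text \<open>The mean value inequality between 0 and \<open>h\<close>, with the derivative controlled
  by \<open>bernstein\<close>.\<close>

lemma difference_bound:
  fixes a :: "'k \<Rightarrow> complex" and \<phi> :: "'k \<Rightarrow> int"
  assumes "finite K"
    and supp: "\<And>k. k \<in> K \<Longrightarrow> a k \<noteq> 0 \<Longrightarrow> \<bar>real_of_int (\<phi> k)\<bar> \<le> X"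
    and bd: "\<And>t. cmod (\<Sum>k\<in>K. a k * cis (real_of_int (\<phi> k) * t)) \<le> B"
    and "X \<ge> 0"
  shows "cmod (\<Sum>k\<in>K. (cis (real_of_int (\<phi> k) * h) - 1) * a k) \<le> 2 * X * \<bar>h\<bar> * B"
proof -
  define T where "T = (\<lambda>t. \<Sum>k\<in>K. a k * cis (real_of_int (\<phi> k) * t))"
  define T' where "T' = (\<lambda>t. \<Sum>k\<in>K. of_int (\<phi> k) * a k * cis (real_of_int (\<phi> k) * t))"
  have "0 \<le> B"
    using bd[of 0] norm_ge_zero order_trans by blast
  have deriv: "(T has_vector_derivative \<i> * T' t) (at t within S)" for t S
    unfolding T_def T'_def has_vector_derivative_def
    by (auto intro!: derivative_eq_intros sum.cong ext simp: sum_distrib_left scaleR_conv_of_real mult_ac)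
  have T': "cmod (\<i> * T' t) \<le> 2 * X * B" for t
  proof -
    \<comment> \<open>Bernstein wants an integer degree; the floor of \<open>X\<close> still bounds
      the integers \<open>\<bar>\<phi> k\<bar>\<close>.\<close>
    have "cmod (T' t) \<le> 2 * real (nat \<lfloor>X\<rfloor>) * B"
      unfolding T'_def
      by (rule bernstein[OF assms(1) _ bd]) (use supp \<open>X \<ge> 0\<close> in \<open>force simp: le_floor_iff\<close>)
    also have "\<dots> \<le> 2 * X * B"
      using \<open>X \<ge> 0\<close> \<open>0 \<le> B\<close> by (intro mult_right_mono) auto
    finally show ?thesis
      by (simp add: norm_mult)
  qed
  have "cmod (T h - T 0) \<le> 2 * X * B * norm (h - 0)"
  proof (rule differentiable_bound[OF convex_UNIV])
    show "(T has_derivative (\<lambda>u. u *\<^sub>R (\<i> * T' t))) (at t)" for t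
      using deriv[of t UNIV] by (simp add: has_vector_derivative_def)
    show "onorm (\<lambda>u. u *\<^sub>R (\<i> * T' t)) \<le> 2 * X * B" for t
      by (rule onorm_le) (use mult_right_mono[OF T'[of t] abs_ge_zero] in \<open>simp add: mult.commute\<close>)
  qed auto
  also have "T h - T 0 = (\<Sum>k\<in>K. (cis (real_of_int (\<phi> k) * h) - 1) * a k)"
    by (simp add: T_def algebra_simps sum_subtractf)
  finally show ?thesis
    by (simp add: algebra_simps)
qed

text \<open>A trapezoid: 1 up to \<open>m\<close>, then linear down to 0 at \<open>2 * m\<close>.
  The coefficients 2 and -1 of the Fejer multipliers give it norm at most 3.\<close>

definition vallee_poussin :: "nat \<Rightarrow> int \<Rightarrow> real" where
  "vallee_poussin m k = 2 * fejer (2 * m) k - fejer m k"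

text \<open>Differences of consecutive trapezoids: the blocks up to \<open>n\<close> telescope to a
  function that is 1 on frequencies up to \<open>2 ^ n\<close>, while block \<open>s\<close> alone
  sees only frequencies of size about \<open>2 ^ s\<close>.\<close>

definition dyadic_block :: "nat \<Rightarrow> int \<Rightarrow> real" where
  "dyadic_block s k =
    (case s of 0 \<Rightarrow> vallee_poussin 1 k | Suc r \<Rightarrow> vallee_poussin (2 ^ Suc r) k - vallee_poussin (2 ^ r) k)"

lemma vallee_poussin_eq_1: "m > 0 \<Longrightarrow> \<bar>k\<bar> \<le> int m \<Longrightarrow> vallee_poussin m k = 1"
  by (auto simp: vallee_poussin_def fejer_def max_def field_simps)

lemma vallee_poussin_eq_0: "m > 0 \<Longrightarrow> \<bar>k\<bar> \<ge> 2 * int m \<Longrightarrow> vallee_poussin m k = 0"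
  by (auto simp: vallee_poussin_def fejer_def max_def field_simps)

lemma sum_dyadic_block: "(\<Sum>s\<le>n. dyadic_block s k) = vallee_poussin (2 ^ n) k"
  by (induction n) (auto simp: dyadic_block_def)

text \<open>Above this range the trapezoids vanish; below it both are 1 and cancel. The maximum with
  1 matches the factors of the hyperbolic cross.\<close>

lemma dyadic_block_support:
  assumes "dyadic_block s k \<noteq> 0"
  shows "\<bar>k\<bar> \<le> 2 * 2 ^ s" "2 ^ s \<le> 2 * max \<bar>k\<bar> 1"
proof -
  show "\<bar>k\<bar> \<le> 2 * 2 ^ s"
  proof (rule ccontr)
    assume "\<not> ?thesis"
    then show False
      using assms vallee_poussin_eq_0[of "2 ^ s" k] vallee_poussin_eq_0[of "2 ^ (s - 1)" k]
      by (auto simp: dyadic_block_def split: nat.splits)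
  qed
  show "2 ^ s \<le> 2 * max \<bar>k\<bar> 1"
  proof (cases s)
    case (Suc r)
    show ?thesis
    proof (rule ccontr)
      assume "\<not> ?thesis"
      then have "\<bar>k\<bar> \<le> 2 ^ r" "\<bar>k\<bar> \<le> 2 * 2 ^ r"
        using Suc by auto
      then show False
        using assms vallee_poussin_eq_1[of "2 ^ Suc r" k] vallee_poussin_eq_1[of "2 ^ r" k]
        by (simp add: dyadic_block_def Suc)
    qed
  qed auto
qed

section \<open>Mixed differences on slices\<close>

definition wave :: "int ^ 'd \<Rightarrow> real ^ 'd \<Rightarrow> complex" where
  "wave k x = cis (\<Sum>j\<in>UNIV. real_of_int (k $ j) * x $ j)"

definition trig_sum :: "(int ^ 'd) set \<Rightarrow> (int ^ 'd \<Rightarrow> complex) \<Rightarrow> real ^ 'd \<Rightarrow> complex" where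
  "trig_sum K c x = (\<Sum>k\<in>K. c k * wave k x)"

text \<open>The free coordinates \<open>A\<close> run over the whole real line and not only over a
  period, so translates along them stay in the slice.\<close>

definition slice :: "'d set \<Rightarrow> real ^ 'd \<Rightarrow> (real ^ 'd) set" where
  "slice A y = {x. \<forall>j. j \<notin> A \<longrightarrow> x $ j = y $ j}"

lemma self_in_slice [simp]: "y \<in> slice A y"
  by (simp add: slice_def)

lemma wave_axis: "wave k (x + axis j t) = wave k x * cis (real_of_int (k $ j) * t)"
proof -
  have "(\<Sum>i\<in>UNIV. real_of_int (k $ i) * (x + axis j t) $ i) =
      (\<Sum>i\<in>UNIV. real_of_int (k $ i) * x $ i) + (\<Sum>i\<in>UNIV. if i = j then real_of_int (k $ j) * t else 0)"
    unfolding sum.distrib[symmetric] by (rule sum.cong) (auto simp: axis_def ring_distribs)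
  then show ?thesis
    by (simp add: wave_def cis_mult)
qed

text \<open>Phrased for coefficients, because multipliers and differences act on them; operator
  norms appear as the passage from \<open>B\<close> to a multiple of \<open>B\<close>.\<close>

definition slice_bdd ::
    "(int ^ 'd) set \<Rightarrow> 'd set \<Rightarrow> real ^ 'd \<Rightarrow> (int ^ 'd \<Rightarrow> complex) \<Rightarrow> real \<Rightarrow> bool" where
  "slice_bdd K A y c B \<longleftrightarrow> (\<forall>x\<in>slice A y. cmod (trig_sum K c x) \<le> B)"

section \<open>One-variable multiplier bounds carried over to slices\<close>

lemma slice_bdd_nonneg: "slice_bdd K A y c B \<Longrightarrow> 0 \<le> B"
  unfolding slice_bdd_def using norm_ge_zero order_trans self_in_slice by blast

text \<open>Moving along a free coordinate turns the sum into a univariate trigonometric polynomial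
  in \<open>t\<close> with frequencies \<open>k $ j\<close>, the form to which the one-variable
  bounds apply.\<close>

lemma slice_bdd_section:
  assumes "slice_bdd K A y c B" "j \<in> A" "x \<in> slice A y"
  shows "cmod (\<Sum>k\<in>K. c k * wave k x * cis (real_of_int (k $ j) * t)) \<le> B"
proof -
  have "x + axis j t \<in> slice A y"
    using assms by (auto simp: slice_def axis_def)
  then have "cmod (trig_sum K c (x + axis j t)) \<le> B"
    using assms by (auto simp: slice_bdd_def)
  then show ?thesis
    by (simp add: trig_sum_def wave_axis mult.assoc)
qed

lemma slice_bdd_fejer:
  assumes "finite K" "slice_bdd K A y c B" "j \<in> A" "m > 0"
  shows "slice_bdd K A y (\<lambda>k. of_real (fejer m (k $ j)) * c k) B"
  unfolding slice_bdd_def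
proof
  fix x assume x: "x \<in> slice A y"
  show "cmod (trig_sum K (\<lambda>k. of_real (fejer m (k $ j)) * c k) x) \<le> B"
    using fejer_bound[OF assms(1,4) slice_bdd_section[OF assms(2,3) x], of 0]
    by (simp add: trig_sum_def mult.assoc)
qed

lemma slice_bdd_diff:
  assumes "slice_bdd K A y c B" "slice_bdd K A y c' B'"
  shows "slice_bdd K A y (\<lambda>k. c k - c' k) (B + B')"
  unfolding slice_bdd_def
proof
  fix x assume x: "x \<in> slice A y"
  have "trig_sum K (\<lambda>k. c k - c' k) x = trig_sum K c x - trig_sum K c' x"
    by (simp add: trig_sum_def ring_distribs sum_subtractf)
  then show "cmod (trig_sum K (\<lambda>k. c k - c' k) x) \<le> B + B'"
    using assms x norm_triangle_ineq4[of "trig_sum K c x" "trig_sum K c' x"]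
    by (force simp: slice_bdd_def)
qed

lemma slice_bdd_sum:
  assumes "\<And>s. s \<in> S \<Longrightarrow> slice_bdd K A y (c s) (B s)"
  shows "slice_bdd K A y (\<lambda>k. \<Sum>s\<in>S. c s k) (\<Sum>s\<in>S. B s)"
  unfolding slice_bdd_def
proof
  fix x assume x: "x \<in> slice A y"
  have "trig_sum K (\<lambda>k. \<Sum>s\<in>S. c s k) x = (\<Sum>s\<in>S. trig_sum K (c s) x)"
    unfolding trig_sum_def sum_distrib_right by (rule sum.swap)
  then show "cmod (trig_sum K (\<lambda>k. \<Sum>s\<in>S. c s k) x) \<le> (\<Sum>s\<in>S. B s)"
    using assms x by (auto simp: slice_bdd_def intro!: sum_norm_le)
qed

lemma slice_bdd_vallee_poussin:
  assumes "finite K" "slice_bdd K A y c B" "j \<in> A" "m > 0"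
  shows "slice_bdd K A y (\<lambda>k. of_real (vallee_poussin m (k $ j)) * c k) (3 * B)"
proof -
  have f: "slice_bdd K A y (\<lambda>k. of_real (fejer (2 * m) (k $ j)) * c k) B"
    by (rule slice_bdd_fejer[OF assms(1-3)]) (use assms in simp)
  \<comment> \<open>The factor 2 is written with differences only, as u - (v - u) = 2 u - v, so that
    \<open>slice_bdd_diff\<close> suffices.\<close>
  have "slice_bdd K A y (\<lambda>k. of_real (fejer (2 * m) (k $ j)) * c k -
      (of_real (fejer m (k $ j)) * c k - of_real (fejer (2 * m) (k $ j)) * c k)) (B + (B + B))"
    by (intro slice_bdd_diff f slice_bdd_fejer[OF assms])
  then show ?thesis
    by (simp add: vallee_poussin_def algebra_simps)
qed

lemma slice_bdd_dyadic_block: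
  assumes "finite K" "slice_bdd K A y c B" "j \<in> A"
  shows "slice_bdd K A y (\<lambda>k. of_real (dyadic_block s (k $ j)) * c k) (6 * B)"
proof (cases s)
  case 0
  have "slice_bdd K A y (\<lambda>k. of_real (vallee_poussin 1 (k $ j)) * c k) (3 * B)"
    by (rule slice_bdd_vallee_poussin[OF assms]) simp
  \<comment> \<open>The lowest block costs only \<open>3 * B\<close>; it is relaxed to the constant
    common to all blocks.\<close>
  then show ?thesis
    using slice_bdd_nonneg[OF assms(2)] by (force simp: 0 dyadic_block_def slice_bdd_def)
next
  case (Suc r)
  have "slice_bdd K A y (\<lambda>k. of_real (vallee_poussin (2 ^ Suc r) (k $ j)) * c k -
      of_real (vallee_poussin (2 ^ r) (k $ j)) * c k) (3 * B + 3 * B)"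
    by (intro slice_bdd_diff slice_bdd_vallee_poussin[OF assms]) simp_all
  then show ?thesis
    by (simp add: Suc dyadic_block_def algebra_simps)
qed

lemma slice_bdd_difference:
  assumes "finite K" "slice_bdd K A y c B" "j \<in> A" "X \<ge> 0"
    and "\<And>k. k \<in> K \<Longrightarrow> c k \<noteq> 0 \<Longrightarrow> \<bar>real_of_int (k $ j)\<bar> \<le> X"
  shows "slice_bdd K A y (\<lambda>k. (cis (real_of_int (k $ j) * h) - 1) * c k) (2 * X * \<bar>h\<bar> * B)"
  unfolding slice_bdd_def
proof
  fix x assume x: "x \<in> slice A y"
  have "cmod (\<Sum>k\<in>K. (cis (real_of_int (k $ j) * h) - 1) * (c k * wave k x)) \<le> 2 * X * \<bar>h\<bar> * B"
    by (rule difference_bound[OF assms(1) _ slice_bdd_section[OF assms(2,3) x] assms(4)])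
      (use assms(5) in auto)
  then show "cmod (trig_sum K (\<lambda>k. (cis (real_of_int (k $ j) * h) - 1) * c k) x) \<le> 2 * X * \<bar>h\<bar> * B"
    by (simp add: trig_sum_def mult.assoc)
qed

text \<open>Induction on \<open>J\<close>. On block \<open>s\<close> of the new coordinate the
  difference costs a factor of order \<open>2 ^ s\<close>, while the product over the remaining
  coordinates is at most \<open>2 * X / 2 ^ s\<close>. These powers cancel, so each of the
  \<open>n + 1\<close> blocks contributes the same amount, with constant 2 * 2 * 6 * 2 = 48.\<close>

lemma slice_bdd_mixed_difference:
  fixes K :: "(int ^ 'd) set"
  assumes "finite K" and K: "\<And>k j. k \<in> K \<Longrightarrow> \<bar>k $ j\<bar> \<le> 2 ^ n"
    and "J \<noteq> {}" "J \<subseteq> A"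
    and "slice_bdd K A y c B" "X \<ge> 0"
    and "\<And>k. k \<in> K \<Longrightarrow> c k \<noteq> 0 \<Longrightarrow> (\<Prod>j\<in>J. real_of_int (max \<bar>k $ j\<bar> 1)) \<le> X"
  shows "slice_bdd K A y (\<lambda>k. (\<Prod>j\<in>J. cis (real_of_int (k $ j) * h j) - 1) * c k)
    (2 * (48 * real (Suc n)) ^ (card J - 1) * (\<Prod>j\<in>J. \<bar>h j\<bar>) * X * B)"
proof -
  have "finite J"
    by simp
  then show ?thesis
    using assms(3-7)
  proof (induction J arbitrary: c B X rule: finite_ne_induct)
    case (singleton j)
    \<comment> \<open>The last coordinate is not split into blocks, which saves one factor
      \<open>n + 1\<close> and explains the exponent \<open>card J - 1\<close>.\<close>
    have "\<bar>real_of_int (k $ j)\<bar> \<le> X" if "k \<in> K" "c k \<noteq> 0" for k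
      using singleton.prems(4)[OF that] by simp
    then show ?case
      using slice_bdd_difference[OF assms(1) singleton.prems(2) _ singleton.prems(3), of j "h j"]
        singleton.prems(1) by (simp add: mult_ac)
  next
    case (insert j J)
    define b where "b = (\<lambda>s k. (cis (real_of_int (k $ j) * h j) - 1) * (of_real (dyadic_block s (k $ j)) * c k))"
    have j: "j \<in> A"
      using insert.prems by auto
    have P1: "(\<Prod>i\<in>J. real_of_int (max \<bar>k $ i\<bar> 1)) \<ge> 1" for k :: "int ^ 'd"
      by (rule prod_ge_1) auto
    have block: "slice_bdd K A y (b s) (2 * (2 * 2 ^ s) * \<bar>h j\<bar> * (6 * B))" for s
      unfolding b_def
    proof (rule slice_bdd_difference[OF assms(1) slice_bdd_dyadic_block[OF assms(1) insert.prems(2) j] j])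
      fix k assume "complex_of_real (dyadic_block s (k $ j)) * c k \<noteq> 0"
      then have "\<bar>k $ j\<bar> \<le> 2 * 2 ^ s"
        by (intro dyadic_block_support) auto
      then have "real_of_int \<bar>k $ j\<bar> \<le> real_of_int (2 * 2 ^ s)"
        by (simp only: of_int_le_iff)
      then show "\<bar>real_of_int (k $ j)\<bar> \<le> 2 * 2 ^ s"
        by simp
    qed simp
    have support: "(\<Prod>i\<in>J. real_of_int (max \<bar>k $ i\<bar> 1)) \<le> 2 * X / 2 ^ s"
      if "k \<in> K" "b s k \<noteq> 0" for k s
    proof -
      have "dyadic_block s (k $ j) \<noteq> 0" "c k \<noteq> 0"
        using that by (auto simp: b_def)
      then have "2 ^ s \<le> 2 * max \<bar>k $ j\<bar> 1"
        by (intro dyadic_block_support)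
      then have "real_of_int (2 ^ s) \<le> real_of_int (2 * max \<bar>k $ j\<bar> 1)"
        by (simp only: of_int_le_iff)
      then have "2 ^ s * (\<Prod>i\<in>J. real_of_int (max \<bar>k $ i\<bar> 1)) \<le>
          2 * (real_of_int (max \<bar>k $ j\<bar> 1) * (\<Prod>i\<in>J. real_of_int (max \<bar>k $ i\<bar> 1)))"
        using P1[of k] by (subst mult.assoc[symmetric]) (intro mult_right_mono, auto)
      also have "\<dots> \<le> 2 * X"
        using insert.prems(4)[OF that(1) \<open>c k \<noteq> 0\<close>] insert.hyps by simp
      finally show ?thesis
        by (simp add: field_simps)
    qed
    \<comment> \<open>The induction hypothesis is used on the already differenced block
      \<open>b s\<close>, with \<open>X\<close> replaced by \<open>2 * X / 2 ^ s\<close>.\<close>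
    have "slice_bdd K A y (\<lambda>k. \<Sum>s\<le>n. (\<Prod>i\<in>J. cis (real_of_int (k $ i) * h i) - 1) * b s k)
        (\<Sum>s\<le>n. 2 * (48 * real (Suc n)) ^ (card J - 1) * (\<Prod>i\<in>J. \<bar>h i\<bar>) * (2 * X / 2 ^ s) *
          (2 * (2 * 2 ^ s) * \<bar>h j\<bar> * (6 * B)))"
      by (intro slice_bdd_sum insert.IH block support) (use insert.prems in auto)
    moreover have "(\<Sum>s\<le>n. 2 * (48 * real (Suc n)) ^ (card J - 1) * (\<Prod>i\<in>J. \<bar>h i\<bar>) * (2 * X / 2 ^ s) *
          (2 * (2 * 2 ^ s) * \<bar>h j\<bar> * (6 * B))) =
        2 * (48 * real (Suc n)) ^ (card (insert j J) - 1) * (\<Prod>i\<in>insert j J. \<bar>h i\<bar>) * X * B"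
    proof -
      have "card J > 0"
        using insert.hyps by (simp add: card_gt_0_iff)
      then obtain p where p: "card J = Suc p"
        using gr0_implies_Suc by blast
      show ?thesis
        using insert.hyps by (simp add: p mult_ac)
    qed
    \<comment> \<open>Nothing is lost in the splitting: the blocks up to \<open>n\<close> sum to 1
      at each \<open>k $ j\<close>, since \<bar>k $ j\<bar> \<le> 2 ^ n on \<open>K\<close>.\<close>
    moreover have "trig_sum K (\<lambda>k. \<Sum>s\<le>n. (\<Prod>i\<in>J. cis (real_of_int (k $ i) * h i) - 1) * b s k) =
        trig_sum K (\<lambda>k. (\<Prod>i\<in>insert j J. cis (real_of_int (k $ i) * h i) - 1) * c k)"
    proof (intro ext, unfold trig_sum_def, intro sum.cong refl)
      fix x k assume "k \<in> K"
      then have one: "(\<Sum>s\<le>n. dyadic_block s (k $ j)) = 1"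
        using K[of k j] by (simp add: sum_dyadic_block vallee_poussin_eq_1)
      have "(\<Sum>s\<le>n. (\<Prod>i\<in>J. cis (real_of_int (k $ i) * h i) - 1) * b s k) =
          (\<Prod>i\<in>insert j J. cis (real_of_int (k $ i) * h i) - 1) * c k *
            of_real (\<Sum>s\<le>n. dyadic_block s (k $ j))"
        unfolding of_real_sum sum_distrib_left
        by (rule sum.cong) (use insert.hyps in \<open>auto simp: b_def mult_ac\<close>)
      then show "(\<Sum>s\<le>n. (\<Prod>i\<in>J. cis (real_of_int (k $ i) * h i) - 1) * b s k) * wave k x =
          (\<Prod>i\<in>insert j J. cis (real_of_int (k $ i) * h i) - 1) * c k * wave k x"
        by (simp add: one)
    qed
    ultimately show ?case
      unfolding slice_bdd_def by (simp only:)
  qed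
qed

section \<open>Passing from a slice to its grid faces\<close>

lemma trig_sum_mixed_difference:
  fixes h :: "'d::finite \<Rightarrow> real"
  shows
  "trig_sum K (\<lambda>k. (\<Prod>j\<in>A. cis (real_of_int (k $ j) * h j) - 1) * c k) x =
    (\<Sum>e\<in>Pow A. (-1) ^ card (A - e) * trig_sum K c (\<chi> j. if j \<in> e then x $ j + h j else x $ j))"
proof -
  have expand: "(\<Prod>j\<in>A. cis (real_of_int (k $ j) * h j) - 1) * wave k x =
      (\<Sum>e\<in>Pow A. (-1) ^ card (A - e) * wave k (\<chi> j. if j \<in> e then x $ j + h j else x $ j))"
    for k :: "int ^ 'd"
  proof -
    have prod_cis: "(\<Prod>j\<in>e. cis (f j)) = cis (sum f e)" for e :: "'d set" and f
      by (induction e rule: infinite_finite_induct) (auto simp: cis_mult)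
    have "(\<Prod>j\<in>e. cis (real_of_int (k $ j) * h j)) * wave k x =
        wave k (\<chi> j. if j \<in> e then x $ j + h j else x $ j)" for e :: "'d set"
    proof -
      have "(\<Sum>j\<in>e. real_of_int (k $ j) * h j) + (\<Sum>j\<in>UNIV. real_of_int (k $ j) * x $ j) =
          (\<Sum>j\<in>UNIV. (if j \<in> e then real_of_int (k $ j) * h j else 0) + real_of_int (k $ j) * x $ j)"
        by (simp add: sum.distrib sum.If_cases)
      also have "\<dots> = (\<Sum>j\<in>UNIV. real_of_int (k $ j) * (if j \<in> e then x $ j + h j else x $ j))"
        by (rule sum.cong) (auto simp: ring_distribs)
      finally show ?thesis
        by (simp add: wave_def prod_cis cis_mult)
    qed
    moreover have "(\<Prod>j\<in>A. cis (real_of_int (k $ j) * h j) - 1) =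
        (\<Sum>e\<in>Pow A. (\<Prod>j\<in>e. cis (real_of_int (k $ j) * h j)) * (-1) ^ card (A - e))"
      using prod_add[of A "\<lambda>j. cis (real_of_int (k $ j) * h j)" "\<lambda>_. - 1"] by simp
    ultimately show ?thesis
      by (simp add: sum_distrib_right mult.assoc mult.left_commute[of _ "(- 1) ^ _"])
  qed
  have "trig_sum K (\<lambda>k. (\<Prod>j\<in>A. cis (real_of_int (k $ j) * h j) - 1) * c k) x =
      (\<Sum>k\<in>K. c k * ((\<Prod>j\<in>A. cis (real_of_int (k $ j) * h j) - 1) * wave k x))"
    by (simp add: trig_sum_def mult_ac)
  also have "\<dots> = (\<Sum>e\<in>Pow A. \<Sum>k\<in>K. c k * ((-1) ^ card (A - e) *
      wave k (\<chi> j. if j \<in> e then x $ j + h j else x $ j)))"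
    unfolding expand sum_distrib_left by (rule sum.swap)
  finally show ?thesis
    by (simp add: trig_sum_def sum_distrib_left mult_ac)
qed

text \<open>A crude bound that makes suprema over slices finite, so that they can be
  absorbed.\<close>

lemma trig_sum_norm_le:
  "cmod (trig_sum K c x) \<le> (\<Sum>k\<in>K. cmod (c k))"
  unfolding trig_sum_def by (rule sum_norm_le) (simp add: wave_def norm_mult)

text \<open>The mixed difference that moves \<open>x\<close> to the grid is at most half the
  supremum \<open>S\<close>. Among its terms only the unshifted one lies off the faces, so it is at
  most \<open>S / 2\<close> plus the face terms; taking the supremum absorbs
  \<open>S / 2\<close>.\<close>

lemma bound_from_faces:
  fixes K :: "(int ^ 'd) set"
  assumes "finite K" and K: "\<And>k j. k \<in> K \<Longrightarrow> \<bar>k $ j\<bar> \<le> 2 ^ n"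
    and X: "\<And>k. k \<in> K \<Longrightarrow> (\<Prod>j\<in>A. real_of_int (max \<bar>k $ j\<bar> 1)) \<le> X" "X \<ge> 0"
    and "A \<noteq> {}" "\<delta> > 0"
    and small: "2 * (48 * real (Suc n)) ^ (card A - 1) * \<delta> ^ card A * X \<le> 1 / 2"
    and faces: "\<And>x j q. x \<in> slice A y \<Longrightarrow> j \<in> A \<Longrightarrow> x $ j = \<delta> * real_of_int q \<Longrightarrow>
      cmod (trig_sum K c x) \<le> D"
    and x: "x \<in> slice A y"
  shows "cmod (trig_sum K c x) \<le> 2 * 2 ^ card A * D"
proof -
  define f where "f = (\<lambda>x. cmod (trig_sum K c x))"
  define S where "S = (SUP x\<in>slice A y. f x)"
  have bdd: "bdd_above (f ` slice A y)"
    unfolding f_def by (rule bdd_aboveI2) (rule trig_sum_norm_le)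
  have S: "f x \<le> S" if "x \<in> slice A y" for x
    unfolding S_def by (rule cSUP_upper[OF that bdd])
  then have "slice_bdd K A y c S"
    by (auto simp: slice_bdd_def f_def)
  note mixed = slice_bdd_mixed_difference[OF assms(1) K \<open>A \<noteq> {}\<close> order_refl this X(2) X(1)]
  have "0 \<le> S"
    using \<open>slice_bdd K A y c S\<close> by (rule slice_bdd_nonneg)
  have "0 \<le> D"
  proof -
    \<comment> \<open>Setting one free coordinate to 0 gives a point on a face, so \<open>D\<close>
      bounds some modulus.\<close>
    obtain j where "j \<in> A"
      using \<open>A \<noteq> {}\<close> by blast
    then have "cmod (trig_sum K c (\<chi> i. if i = j then \<delta> * real_of_int 0 else y $ i)) \<le> D"
      by (intro faces) (auto simp: slice_def)
    then show ?thesis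
      using norm_ge_zero order_trans by blast
  qed
  have main: "f x \<le> S / 2 + 2 ^ card A * D" if x: "x \<in> slice A y" for x
  proof -
    \<comment> \<open>The steps depend on \<open>x\<close>: each coordinate is lowered to the grid
      multiple just below or at it, so any shifted coordinate lands on the grid.\<close>
    define h where "h = (\<lambda>j. \<delta> * real_of_int \<lfloor>x $ j / \<delta>\<rfloor> - x $ j)"
    have h: "\<bar>h j\<bar> \<le> \<delta>" for j
    proof -
      have "\<delta> * real_of_int \<lfloor>x $ j / \<delta>\<rfloor> \<le> \<delta> * (x $ j / \<delta>)"
          "\<delta> * (x $ j / \<delta>) \<le> \<delta> * (real_of_int \<lfloor>x $ j / \<delta>\<rfloor> + 1)"
        using floor_correct[of "x $ j / \<delta>"] \<open>\<delta> > 0\<close> by (intro mult_left_mono; simp)+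
      then have "\<delta> * real_of_int \<lfloor>x $ j / \<delta>\<rfloor> \<le> x $ j" "x $ j \<le> \<delta> * real_of_int \<lfloor>x $ j / \<delta>\<rfloor> + \<delta>"
        using \<open>\<delta> > 0\<close> by (simp_all add: ring_distribs)
      then show ?thesis
        by (simp add: h_def)
    qed
    define corner where "corner = (\<lambda>e. \<chi> j. if j \<in> e then x $ j + h j else x $ j)"
    define g where "g = (\<lambda>e. (-1) ^ card (A - e) * trig_sum K c (corner e))"
    have "cmod (\<Sum>e\<in>Pow A. g e) \<le> 2 * (48 * real (Suc n)) ^ (card A - 1) * (\<Prod>j\<in>A. \<bar>h j\<bar>) * X * S"
      using mixed[of h] x
      unfolding slice_bdd_def trig_sum_mixed_difference g_def corner_def by blast
    also have "\<dots> \<le> 2 * (48 * real (Suc n)) ^ (card A - 1) * \<delta> ^ card A * X * S"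
      using h X(2) \<open>0 \<le> S\<close> prod_mono[of A "\<lambda>j. \<bar>h j\<bar>" "\<lambda>_. \<delta>"]
      by (intro mult_right_mono mult_left_mono) auto
    also have "\<dots> \<le> 1 / 2 * S"
      using small \<open>0 \<le> S\<close> by (rule mult_right_mono)
    finally have total: "cmod (\<Sum>e\<in>Pow A. g e) \<le> S / 2"
      by simp
    have "corner {} = x"
      by (simp add: corner_def vec_eq_iff)
    then have fx: "f x = cmod (g {})"
      by (simp add: f_def g_def norm_mult norm_power)
    have "(\<Sum>e\<in>Pow A. g e) = g {} + (\<Sum>e\<in>Pow A - {{}}. g e)"
      by (rule sum.remove) auto
    then have "f x = cmod ((\<Sum>e\<in>Pow A. g e) - (\<Sum>e\<in>Pow A - {{}}. g e))"
      by (simp add: fx)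
    also have "\<dots> \<le> S / 2 + (\<Sum>e\<in>Pow A - {{}}. D)"
    proof (intro order_trans[OF norm_triangle_ineq4] add_mono total sum_norm_le)
      fix e assume e: "e \<in> Pow A - {{}}"
      then obtain j where j: "j \<in> e" "j \<in> A"
        by blast
      have "cmod (g e) = cmod (trig_sum K c (corner e))"
        by (simp add: g_def norm_mult norm_power)
      also have "\<dots> \<le> D"
        by (rule faces[OF _ j(2)]) (use e j x in \<open>auto simp: slice_def corner_def h_def\<close>)
      finally show "cmod (g e) \<le> D" .
    qed
    also have "(\<Sum>e\<in>Pow A - {{}}. D) \<le> (\<Sum>e\<in>Pow A. D)"
      using \<open>0 \<le> D\<close> by (intro sum_mono2) auto
    finally show ?thesis
      by (simp add: card_Pow)
  qed
  \<comment> \<open>Subtracting \<open>S / 2\<close> from this gives S \<le> 2 * 2 ^ card A *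
    D.\<close>
  have "S \<le> S / 2 + 2 ^ card A * D"
    by (subst S_def, rule cSUP_least) (use main self_in_slice in blast)+
  then show ?thesis
    using S[OF x] by (simp add: f_def)
qed

section \<open>Sampling sets\<close>

lemma hyperbolic_cross_prod_le:
  fixes k :: "int ^ 'd"
  assumes "k \<in> hyperbolic_cross N"
  shows "(\<Prod>j\<in>A. max \<bar>k $ j\<bar> 1) \<le> int N"
proof -
  have "(\<Prod>j\<in>A. max \<bar>k $ j\<bar> 1) \<le> (\<Prod>j\<in>UNIV. max \<bar>k $ j\<bar> 1)"
    by (rule prod_mono2) auto
  then show ?thesis
    using assms by (simp add: hyperbolic_cross_def)
qed

lemma log_factor_ge_half: "log_factor N \<ge> 1 / 2"
proof -
  have "ln 2 \<le> log_factor N"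
    unfolding log_factor_def by (rule ln_mono) auto
  then show ?thesis
    using ln2_ge_two_thirds by linarith
qed

text \<open>For \<open>Suc a\<close> free coordinates \<open>M\<close> is about (N (log
  N)^a)^(1/(a+1)), and the step 2 pi / M then meets the smallness condition of
  \<open>bound_from_faces\<close> with \<open>X = N\<close>. Dividing the period exactly makes the
  grid finite modulo periods.\<close>

lemma grid_size:
  fixes a :: nat
  obtains P where "P > 0" and "\<And>N. N \<ge> 1 \<Longrightarrow> \<exists>M n. M > 0 \<and> N \<le> 2 ^ n \<and>
    2 * (48 * real (Suc n)) ^ a * (2 * pi / real M) ^ Suc a * real N \<le> 1 / 2 \<and>
    real M \<le> P * real N powr (1 / real (Suc a)) * log_factor N powr (real a / real (Suc a))"
proof -
  \<comment> \<open>\<open>c0\<close> gives n + 1 \<le> c0 log N: one share of the 3 covers log2 N,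
    the other two absorb the 2 lost to \<open>Suc\<close> and the ceiling. \<open>Q\<close> then
    collects the constants of the smallness condition, and \<open>q\<close> is chosen with
    \<open>q ^ Suc a = 2 * Q\<close>.\<close>
  define c0 where "c0 = 3 / ln (2 :: real)"
  define Q where "Q = 2 * (48 * c0) ^ a"
  define q where "q = (2 * Q) powr (1 / real (Suc a))"
  define P where "P = 2 * pi * q + 2"
  have "c0 > 0"
    by (simp add: c0_def)
  then have "Q > 0"
    by (simp add: Q_def)
  then have q: "q > 0" "q ^ Suc a = 2 * Q"
    by (simp_all add: q_def powr_power del: power_Suc of_nat_Suc)
  show thesis
  proof
    show "P > 0"
      using q by (simp add: P_def add_pos_pos)
  next
    fix N :: nat assume N: "N \<ge> 1"
    define L where "L = log_factor N"
    define X where "X = real N * L ^ a"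
    define r where "r = X powr (1 / real (Suc a))"
    define M where "M = nat \<lceil>2 * pi * q * r\<rceil>"
    define n where "n = nat \<lceil>log 2 (real N)\<rceil>"
    have L: "L \<ge> 1 / 2"
      unfolding L_def by (rule log_factor_ge_half)
    then have "L > 0"
      by linarith
    then have "X > 0"
      using N by (simp add: X_def)
    then have r: "r > 0" "r ^ Suc a = X"
      by (simp_all add: r_def powr_power del: power_Suc of_nat_Suc)
    \<comment> \<open>A lower bound for \<open>r\<close> lets the rounding error 1 in
      \<open>M\<close> be absorbed as \<open>2 * r\<close>; this is the summand 2 in
      \<open>P\<close>.\<close>
    have "(1 / 2) ^ Suc a \<le> (1 / 2 :: real) ^ a"
      by simp
    also have "\<dots> \<le> L ^ a"
      using L by (intro power_mono) auto
    also have "\<dots> \<le> X"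
      using N \<open>L > 0\<close> by (simp add: X_def)
    finally have "r \<ge> 1 / 2"
      unfolding r(2)[symmetric] using r(1) by (intro power_le_imp_le_base[of "1 / 2" a r]) auto
    have log_nonneg: "log 2 (real N) \<ge> 0"
      using N by simp
    have "real N = 2 powr log 2 (real N)"
      using N by simp
    also have "\<dots> \<le> 2 powr real n"
      using log_nonneg by (intro powr_mono) (auto simp: n_def of_nat_ceiling)
    finally have "real N \<le> real (2 ^ n)"
      by (simp add: powr_realpow)
    then have Nn: "N \<le> 2 ^ n"
      by (simp only: of_nat_le_iff)
    have "ln (real N) \<le> L"
      unfolding L_def log_factor_def using N by (intro ln_mono) auto
    then have "log 2 (real N) \<le> L / ln 2"
      by (simp add: log_def divide_right_mono)
    moreover have "ln 2 \<le> L"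
      unfolding L_def log_factor_def by (intro ln_mono) auto
    then have "2 \<le> 2 * (L / ln 2)"
      by (simp add: pos_le_divide_eq)
    moreover have "real (Suc n) \<le> log 2 (real N) + 2"
      using log_nonneg by (simp add: n_def) linarith
    ultimately have n: "real (Suc n) \<le> c0 * L"
      by (simp add: c0_def)
    have M: "2 * pi * q * r \<le> real M"
      unfolding M_def by (rule real_nat_ceiling_ge)
    have qr: "2 * pi * q * r > 0"
      using q r by simp
    then have "M > 0"
      using M by linarith
    have "2 * pi / real M \<le> 1 / (q * r)"
      using M q r \<open>M > 0\<close> by (simp add: field_simps)
    then have "(2 * pi / real M) ^ Suc a \<le> (1 / (q * r)) ^ Suc a"
      by (intro power_mono) auto
    also have "\<dots> = 1 / (2 * Q * X)"
      by (simp only: power_divide power_mult_distrib q r power_one)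
    finally have "2 * (48 * real (Suc n)) ^ a * (2 * pi / real M) ^ Suc a * real N \<le>
        2 * (48 * (c0 * L)) ^ a * (1 / (2 * Q * X)) * real N"
      using n \<open>c0 > 0\<close> \<open>L > 0\<close>
      by (intro mult_right_mono mult_mono power_mono mult_left_mono) auto
    also have "\<dots> = Q * X / (2 * Q * X)"
      by (simp add: Q_def X_def power_mult_distrib)
    also have "\<dots> = 1 / 2"
      using \<open>Q > 0\<close> \<open>X > 0\<close> by simp
    finally have small: "2 * (48 * real (Suc n)) ^ a * (2 * pi / real M) ^ Suc a * real N \<le> 1 / 2" .
    have "real M \<le> 2 * pi * q * r + 1"
      unfolding M_def using qr by linarith
    also have "\<dots> \<le> P * r"
      using \<open>r \<ge> 1 / 2\<close> by (simp add: P_def algebra_simps)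
    also have "r = real N powr (1 / real (Suc a)) * L powr (real a / real (Suc a))"
      using \<open>L > 0\<close> by (simp add: r_def X_def powr_mult powr_powr flip: powr_realpow)
    finally show "\<exists>M n. M > 0 \<and> N \<le> 2 ^ n \<and>
        2 * (48 * real (Suc n)) ^ a * (2 * pi / real M) ^ Suc a * real N \<le> 1 / 2 \<and>
        real M \<le> P * real N powr (1 / real (Suc a)) * log_factor N powr (real a / real (Suc a))"
      using small Nn \<open>M > 0\<close> unfolding L_def by (intro exI[of _ M] exI[of _ n]) (simp add: mult.assoc)
  qed
qed

section \<open>Induction on the number of free coordinates\<close>

lemma trig_sum_periodic:
  fixes x :: "real ^ 'd"
  shows
  "trig_sum K c (x + axis j (2 * pi * real_of_int q)) = trig_sum K c x"
proof -
  have "cis (real_of_int (k $ j) * (2 * pi * real_of_int q)) = 1" for k :: "int ^ 'd"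
    using cis_multiple_2pi[of "real_of_int (k $ j * q)"] by (simp add: mult_ac)
  then show ?thesis
    by (simp add: trig_sum_def wave_axis)
qed

text \<open>The point \<open>w\<close> may depend on \<open>c\<close> and \<open>x\<close>. This
  form makes \<open>W\<close> nonempty and needs no \<open>Max\<close>, so sampling sets of
  different slices can simply be united.\<close>

definition samples :: "nat \<Rightarrow> 'd set \<Rightarrow> real ^ 'd \<Rightarrow> real \<Rightarrow> (real ^ 'd) set \<Rightarrow> bool" where
  "samples N A y C W \<longleftrightarrow> W \<subseteq> slice A y \<inter> torus \<and> finite W \<and>
    (\<forall>c. \<forall>x \<in> slice A y. \<exists>w \<in> W.
      cmod (trig_sum (hyperbolic_cross N) c x) \<le> C * cmod (trig_sum (hyperbolic_cross N) c w))"

text \<open>The constants are chosen before \<open>N\<close>, \<open>A\<close> and \<open>y\<close>,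
  so one induction hypothesis serves all the faces of all slices. A step fixes one of
  \<open>Suc a\<close> coordinates at one of \<open>M\<close> grid values, which multiplies the
  cardinality bound by \<open>Suc a * M\<close>.\<close>

lemma slice_sampling:
  "\<exists>C1 > 0. \<exists>C2 > 0. \<forall>N \<ge> 1. \<forall>A :: 'd::finite set. \<forall>y \<in> torus. card A = a \<longrightarrow>
    (\<exists>W. samples N A y C2 W \<and>
      real (card W) \<le> C1 * real N powr alpha a * log_factor N powr beta a)"
proof (induction a)
  case 0
  show ?case
  proof (rule exI[of _ 1], intro conjI zero_less_one, rule exI[of _ 1], intro conjI zero_less_one allI impI ballI)
    fix N :: nat and A :: "'d set" and y :: "real ^ 'd"
    assume "N \<ge> 1" "y \<in> torus" "card A = 0"
    then have "slice A y = {y}"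
      by (auto simp: slice_def vec_eq_iff)
    \<comment> \<open>Both exponents are 0 here, and \<open>0 powr 0\<close> would be 0 instead of
      1.\<close>
    moreover have "log_factor N \<noteq> 0"
      using log_factor_ge_half[of N] by linarith
    ultimately show "\<exists>W. samples N A y 1 W \<and>
      real (card W) \<le> 1 * real N powr alpha 0 * log_factor N powr beta 0"
      using \<open>N \<ge> 1\<close> \<open>y \<in> torus\<close>
      by (intro exI[of _ "{y}"]) (auto simp: samples_def alpha_def beta_def)
  qed
next
  case (Suc a)
  then obtain C1 C2 where C: "C1 > 0" "C2 > 0" and
    IH: "\<And>N A y. N \<ge> 1 \<Longrightarrow> y \<in> torus \<Longrightarrow> card (A :: 'd set) = a \<Longrightarrow>
    (\<exists>W. samples N A y C2 W \<and>
      real (card W) \<le> C1 * real N powr alpha a * log_factor N powr beta a)"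
    by blast
  obtain P where "P > 0" and P: "\<And>N. N \<ge> 1 \<Longrightarrow> \<exists>M n. M > 0 \<and> N \<le> 2 ^ n \<and>
    2 * (48 * real (Suc n)) ^ a * (2 * pi / real M) ^ Suc a * real N \<le> 1 / 2 \<and>
    real M \<le> P * real N powr (1 / real (Suc a)) * log_factor N powr (real a / real (Suc a))"
    using grid_size by blast
  have exponents: "alpha (Suc a) = 1 / real (Suc a) + alpha a"
      "beta (Suc a) = real a / real (Suc a) + beta a"
    by (simp_all add: alpha_def beta_def field_simps)
  define C1' where "C1' = real (Suc a) * P * C1"
  define C2' where "C2' = 2 * 2 ^ Suc a * C2"
  show ?case
  proof (rule exI[of _ C1'], intro conjI, use C \<open>P > 0\<close> in \<open>simp add: C1'_def\<close>,
      rule exI[of _ C2'], intro conjI allI impI ballI, use C in \<open>simp add: C2'_def\<close>)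
    fix N :: nat and A :: "'d set" and y :: "real ^ 'd"
    assume N: "N \<ge> 1" and y: "y \<in> torus" and A: "card A = Suc a"
    let ?F = "trig_sum (hyperbolic_cross N) :: (int ^ 'd \<Rightarrow> complex) \<Rightarrow> _"
    obtain M n where M: "M > 0" and n: "N \<le> 2 ^ n"
      and small: "2 * (48 * real (Suc n)) ^ a * (2 * pi / real M) ^ Suc a * real N \<le> 1 / 2"
      and M_le: "real M \<le> P * real N powr (1 / real (Suc a)) * log_factor N powr (real a / real (Suc a))"
      using P[OF N] by blast
    define \<delta> where "\<delta> = 2 * pi / real M"
    \<comment> \<open>Base points of the faces: coordinate \<open>j\<close> is fixed at the grid
      value \<open>l\<close>, and l < M keeps it within one period.\<close>
    define z where "z = (\<lambda>j l. \<chi> i. if i = j then \<delta> * real l else y $ i)"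
    have z: "z j l \<in> torus" if "l < M" for j l
      using y that by (auto simp: torus_def z_def \<delta>_def field_simps)
    define V where "V = (\<lambda>j l. SOME W. samples N (A - {j}) (z j l) C2 W \<and>
      real (card W) \<le> C1 * real N powr alpha a * log_factor N powr beta a)"
    have V_samples: "samples N (A - {j}) (z j l) C2 (V j l) \<and>
        real (card (V j l)) \<le> C1 * real N powr alpha a * log_factor N powr beta a"
      if "j \<in> A" "l < M" for j l
    proof -
      have "card (A - {j}) = a"
        using that A by simp
      from IH[OF N z[OF that(2)] this] show ?thesis
        unfolding V_def by (rule someI_ex)
    qed
    have V: "V j l \<subseteq> slice (A - {j}) (z j l) \<inter> torus" "finite (V j l)"
        "real (card (V j l)) \<le> C1 * real N powr alpha a * log_factor N powr beta a"
      if "j \<in> A" "l < M" for j l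
      using V_samples[OF that] by (simp_all add: samples_def)
    have V_bound: "\<exists>w \<in> V j l. cmod (?F c x) \<le> C2 * cmod (?F c w)"
      if "j \<in> A" "l < M" "x \<in> slice (A - {j}) (z j l)" for j l c x
      using V_samples[OF that(1,2)] that(3) unfolding samples_def by blast
    define W where "W = (\<Union>j\<in>A. \<Union>l<M. V j l)"
    have "W \<subseteq> slice A y \<inter> torus"
      using V(1) by (fastforce simp: W_def slice_def z_def)
    moreover have fin: "finite W"
      using V(2) by (auto simp: W_def)
    moreover have "real (card W) \<le> C1' * real N powr alpha (Suc a) * log_factor N powr beta (Suc a)"
    proof -
      let ?b = "C1 * real N powr alpha a * log_factor N powr beta a"
      have "card W \<le> (\<Sum>j\<in>A. \<Sum>l<M. card (V j l))"
        unfolding W_def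
        by (rule order_trans[OF card_UN_le]) (auto intro!: sum_mono card_UN_le)
      then have "real (card W) \<le> (\<Sum>j\<in>A. \<Sum>l<M. real (card (V j l)))"
        by (simp only: of_nat_sum[symmetric] of_nat_le_iff)
      also have "\<dots> \<le> (\<Sum>j\<in>A. \<Sum>l<M. ?b)"
        by (intro sum_mono V) auto
      also have "\<dots> = real (Suc a) * real M * ?b"
        by (simp add: A)
      also have "\<dots> \<le> real (Suc a) *
          (P * real N powr (1 / real (Suc a)) * log_factor N powr (real a / real (Suc a))) * ?b"
        using M_le C by (intro mult_right_mono mult_left_mono) auto
      also have "\<dots> = C1' * real N powr alpha (Suc a) * log_factor N powr beta (Suc a)"
        by (simp add: exponents powr_add C1'_def mult_ac)
      finally show ?thesis .
    qed
    moreover have "\<exists>w\<in>W. cmod (?F c x) \<le> C2' * cmod (?F c w)" if x: "x \<in> slice A y" for c x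
    proof -
      have face: "\<exists>w\<in>W. cmod (?F c x) \<le> C2 * cmod (?F c w)"
        if "x \<in> slice A y" "j \<in> A" "x $ j = \<delta> * real_of_int q" for x j q
      proof -
        \<comment> \<open>The grid index is reduced modulo \<open>M\<close>, and \<open>x\<close> is
          moved by whole periods to a face with a chosen sampling set.\<close>
        define l where "l = nat (q mod int M)"
        define x' where "x' = x + axis j (2 * pi * real_of_int (- (q div int M)))"
        have l: "l < M" and "int l = q mod int M"
          using M by (auto simp: l_def nat_less_iff)
        then have "q = int M * (q div int M) + int l"
          by simp
        from arg_cong[OF this, of real_of_int]
        have "real_of_int q = real M * real_of_int (q div int M) + real l"
          by (simp only: of_int_add of_int_mult of_int_of_nat_eq)
        then have "x' \<in> slice (A - {j}) (z j l)"
          using that M by (auto simp: x'_def slice_def z_def axis_def \<delta>_def field_simps)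
        from V_bound[OF \<open>j \<in> A\<close> l this]
        obtain w where "w \<in> V j l" "cmod (?F c x') \<le> C2 * cmod (?F c w)"
          by blast
        then show ?thesis
          using \<open>j \<in> A\<close> l unfolding x'_def trig_sum_periodic W_def by blast
      qed
      obtain j where j: "j \<in> A"
        using A by fastforce
      have "z j 0 \<in> slice A y" "z j 0 $ j = \<delta> * real_of_int 0"
        using j by (auto simp: slice_def z_def)
      from face[OF this(1) j this(2)] have "W \<noteq> {}"
        by blast
      \<comment> \<open>A single maximising \<open>w\<close> turns the face estimates into one
        number \<open>D\<close>, independent of the face.\<close>
      then have "Max ((\<lambda>w. cmod (?F c w)) ` W) \<in> (\<lambda>w. cmod (?F c w)) ` W"
        using fin by (intro Max_in) auto
      then obtain w where "w \<in> W" and wmax: "Max ((\<lambda>w. cmod (?F c w)) ` W) = cmod (?F c w)"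
        by auto
      have w: "cmod (?F c v) \<le> cmod (?F c w)" if "v \<in> W" for v
        unfolding wmax[symmetric] using fin that by (intro Max_ge) auto
      have "cmod (?F c x) \<le> 2 * 2 ^ card A * (C2 * cmod (?F c w))"
      proof (rule bound_from_faces[where \<delta> = \<delta> and X = "real N" and n = n, OF finite_hyperbolic_cross])
        fix k :: "int ^ 'd" and j
        assume k: "k \<in> hyperbolic_cross N"
        have "int N \<le> 2 ^ n"
          using n by (metis of_nat_le_iff of_nat_numeral of_nat_power)
        moreover have "\<bar>k $ j\<bar> \<le> int N"
          using hyperbolic_cross_prod_le[OF k, of "{j}"] by simp
        ultimately show "\<bar>k $ j\<bar> \<le> 2 ^ n"
          by (rule order_trans[rotated])
        have "real_of_int (\<Prod>j\<in>A. max \<bar>k $ j\<bar> 1) \<le> real_of_int (int N)"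
          using hyperbolic_cross_prod_le[OF k] by (simp only: of_int_le_iff)
        then show "(\<Prod>j\<in>A. real_of_int (max \<bar>k $ j\<bar> 1)) \<le> real N"
          by simp
      next
        fix x j q
        assume "x \<in> slice A y" "j \<in> A" "x $ j = \<delta> * real_of_int q"
        then obtain v where "v \<in> W" "cmod (?F c x) \<le> C2 * cmod (?F c v)"
          using face by blast
        then show "cmod (?F c x) \<le> C2 * cmod (?F c w)"
          using w[of v] C(2) mult_left_mono[of "cmod (?F c v)" "cmod (?F c w)" C2] by linarith
      qed (use A j x M small in \<open>auto simp: \<delta>_def\<close>)
      then show ?thesis
        using \<open>w \<in> W\<close> by (auto simp: C2'_def A mult_ac)
    qed
    ultimately show "\<exists>W. samples N A y C2' W \<and>
      real (card W) \<le> C1' * real N powr alpha (Suc a) * log_factor N powr beta (Suc a)"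
      unfolding samples_def by blast
  qed
qed

theorem theorem5p1:
  shows "\<exists>C1 > 0. \<exists>C2 > 0. \<forall>N :: nat. N \<ge> 1 \<longrightarrow>
    (\<exists>W :: (real ^ 'd) set.
       W \<subseteq> torus \<and> finite W \<and> W \<noteq> {} \<and>
       real (card W) \<le> C1 * real N powr alpha CARD('d) *
         log_factor N powr beta CARD('d) \<and>
       (\<forall>f \<in> trig_polys N. sup_norm f \<le> C2 * Max ((\<lambda>w. cmod (f w)) ` W)))"
proof -
  obtain C1 C2 where C: "C1 > 0" "C2 > 0" and
    sampling: "\<And>N (A :: 'd set) y. N \<ge> 1 \<Longrightarrow> y \<in> torus \<Longrightarrow> card A = CARD('d) \<Longrightarrow>
    (\<exists>W. samples N A y C2 W \<and>
      real (card W) \<le> C1 * real N powr alpha CARD('d) * log_factor N powr beta CARD('d))"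
    using slice_sampling[of "CARD('d)", where 'd = 'd] by blast
  have "(0 :: real ^ 'd) \<in> torus"
    by (simp add: torus_def)
  have "\<exists>W :: (real ^ 'd) set.
       W \<subseteq> torus \<and> finite W \<and> W \<noteq> {} \<and>
       real (card W) \<le> C1 * real N powr alpha CARD('d) * log_factor N powr beta CARD('d) \<and>
       (\<forall>f \<in> trig_polys N. sup_norm f \<le> C2 * Max ((\<lambda>w. cmod (f w)) ` W))"
    if N: "N \<ge> 1" for N
  proof -
    \<comment> \<open>With all coordinates free the slice is the whole space. The sampling property
      also yields that \<open>W\<close> is nonempty.\<close>
    obtain W :: "(real ^ 'd) set" where W: "W \<subseteq> torus" "finite W"
      "real (card W) \<le> C1 * real N powr alpha CARD('d) * log_factor N powr beta CARD('d)"
      "\<And>c x. \<exists>w \<in> W.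
        cmod (trig_sum (hyperbolic_cross N) c x) \<le> C2 * cmod (trig_sum (hyperbolic_cross N) c w)"
      using sampling[OF N \<open>0 \<in> torus\<close>, of UNIV] by (auto simp: samples_def slice_def)
    have "sup_norm f \<le> C2 * Max ((\<lambda>w. cmod (f w)) ` W)" if "f \<in> trig_polys N" for f
    proof -
      obtain c where f: "f = trig_sum (hyperbolic_cross N) c"
        using \<open>f \<in> trig_polys N\<close> by (auto simp: trig_polys_def trig_sum_def wave_def cis_conv_exp fun_eq_iff)
      show ?thesis
        unfolding sup_norm_def
      proof (rule cSUP_least)
        show "(torus :: (real ^ 'd) set) \<noteq> {}"
          using \<open>0 \<in> torus\<close> by blast
        fix x :: "real ^ 'd"
        obtain w where w: "w \<in> W" "cmod (f x) \<le> C2 * cmod (f w)"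
          using W(4)[of c x] f by blast
        then have "cmod (f w) \<le> Max ((\<lambda>w. cmod (f w)) ` W)"
          using W(2) by simp
        then show "cmod (f x) \<le> C2 * Max ((\<lambda>w. cmod (f w)) ` W)"
          using w(2) C(2) by (meson mult_left_mono less_imp_le order_trans)
      qed
    qed
    then show ?thesis
      using W by (intro exI[of _ W]) auto
  qed
  with C show ?thesis
    by blast
qed

end
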